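(* Let $\mathcal{H}$ be a real Hilbert space and let $T:\mathcal{H}\rightrightarrows\mathcal{H}$ be maximal monotone with $T^{-1}(0)\neq\emptyset$. Let $\{z^k\}$ and $\{\bar z^k\}$ be any sequences generated by the Halpern accelerated inexact proximal point algorithm under criterion (B) (both described in the context), with $c_k>0$ nondecreasing, $c_k\nearrow c_\infty\le+\infty$. Assume that $\{z^k\}$ is bounded and that $T^{-1}$ is Lipschitz continuous at $0$ with modulus $a\ge 0$ (in the sense of the context), and let $$\mu_k=\frac{a}{(a^2+c_k^2)^{1/2}}<1 .$$ Then $\{z^k\}$ converges strongly to $\bar z$, the unique solution to $0\in T(z)$. Moreover, there is an index $\bar k$ such that $$\|\bar z^k-\bar z\|\le\vartheta_k\|z^k-\bar z\|\quad\text{for all }k\ge\bar k,$$ where $$1>\vartheta_k=\frac{\mu_k+\delta_k}{1-\delta_k}\ge 0\quad\text{for all }k\ge\bar k,$$ and $\vartheta_k\to\mu_\infty$, where $\mu_\infty=a/(a^2+c_\infty^2)^{1/2}$ if $c_\infty<+\infty$ and $\mu_\infty=0$ if $c_\infty=+\infty$.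
   Context: For $c>0$, $P_c=(I+cT)^{-1}$ is the (single-valued, everywhere defined) proximal mapping of $T$. $T^{-1}(w)=\{z\in\mathcal{H}:w\in T(z)\}$. Halpern accelerated inexact proximal point algorithm: choose $z^0\in\mathcal{H}$ and a sequence of parameters $c_k>0$; for $k=0,1,2,\ldots$ compute $\bar z^k\approx P_{c_k}(z^k)$ according to an inexactness criterion, and set $$z^{k+1}=\frac{1}{k+2}z^0+\frac{k+1}{k+2}\bar z^k .$$ Criterion (B): $\|\bar z^k-P_{c_k}(z^k)\|\le\delta_k\|\bar z^k-z^k\|$ for all $k\ge0$, where $\delta_k\ge 0$ and $\sum_{k=0}^\infty\delta_k<+\infty$. $T^{-1}$ is Lipschitz continuous at $0$ with modulus $a\ge 0$ if there exists a unique solution $\bar z$ to $0\in T(z)$ and for some $\bar\varepsilon>0$ one has $\|z-\bar z\|\le a\|w\|$ whenever $z\in T^{-1}(w)$ and $\|w\|\le\bar\varepsilon$. *)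

theory Defs
  imports "HOL-Analysis.Analysis"
begin

text \<open>
  A set-valued operator on \<open>H\<close> is a function \<open>T :: 'a \<Rightarrow> 'a set\<close>; a real Hilbert space is a
  type of sort \<open>{real_inner, complete_space}\<close>.
\<close>

definition monotone_operator :: "('a::real_inner \<Rightarrow> 'a set) \<Rightarrow> bool" where
  "monotone_operator T \<longleftrightarrow>
     (\<forall>x y u v. u \<in> T x \<longrightarrow> v \<in> T y \<longrightarrow> 0 \<le> (x - y) \<bullet> (u - v))"

definition maximal_monotone :: "('a::real_inner \<Rightarrow> 'a set) \<Rightarrow> bool" where
  "maximal_monotone T \<longleftrightarrow>
     monotone_operator T \<and>
     (\<forall>S. monotone_operator S \<and> (\<forall>x. T x \<subseteq> S x) \<longrightarrow> S = T)"

definition inverse_operator :: "('a \<Rightarrow> 'a set) \<Rightarrow> 'a \<Rightarrow> 'a set" where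
  "inverse_operator T w = {z. w \<in> T z}"

definition resolvent :: "('a::real_vector \<Rightarrow> 'a set) \<Rightarrow> real \<Rightarrow> 'a \<Rightarrow> 'a set" where
  "resolvent T c = inverse_operator (\<lambda>x. {x + c *\<^sub>R v | v. v \<in> T x})"

text \<open>
  \<open>(I + c T)\<inverse>\<close> as a point-valued map. For maximal monotone \<open>T\<close> on a Hilbert space
  and \<open>c > 0\<close> the set \<open>resolvent T c z\<close> is always a singleton (Minty's theorem), so the
  description is meaningful there.
\<close>
definition prox_map :: "('a::real_vector \<Rightarrow> 'a set) \<Rightarrow> real \<Rightarrow> 'a \<Rightarrow> 'a" where
  "prox_map T c z = (THE x. x \<in> resolvent T c z)"

definition halpern_iteration :: "(nat \<Rightarrow> 'a::real_vector) \<Rightarrow> (nat \<Rightarrow> 'a) \<Rightarrow> bool" where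
  "halpern_iteration z zbar \<longleftrightarrow>
     (\<forall>k. z (Suc k) = (1 / (real k + 2)) *\<^sub>R z 0 + ((real k + 1) / (real k + 2)) *\<^sub>R zbar k)"

definition criterion_B ::
  "('a::real_normed_vector \<Rightarrow> 'a set) \<Rightarrow> (nat \<Rightarrow> real) \<Rightarrow> (nat \<Rightarrow> real) \<Rightarrow>
   (nat \<Rightarrow> 'a) \<Rightarrow> (nat \<Rightarrow> 'a) \<Rightarrow> bool" where
  "criterion_B T c \<delta> z zbar \<longleftrightarrow>
     (\<forall>k. 0 \<le> \<delta> k) \<and> summable \<delta> \<and>
     (\<forall>k. norm (zbar k - prox_map T (c k) (z k)) \<le> \<delta> k * norm (zbar k - z k))"

definition inverse_lipschitz_at_0 :: "('a::real_normed_vector \<Rightarrow> 'a set) \<Rightarrow> real \<Rightarrow> bool" where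
  "inverse_lipschitz_at_0 T a \<longleftrightarrow>
     0 \<le> a \<and>
     (\<exists>zs. inverse_operator T 0 = {zs} \<and>
        (\<exists>\<epsilon>>0. \<forall>w z. z \<in> inverse_operator T w \<longrightarrow> norm w \<le> \<epsilon> \<longrightarrow> norm (z - zs) \<le> a * norm w))"

definition mu :: "real \<Rightarrow> real \<Rightarrow> real" where
  "mu a c = a / sqrt (a\<^sup>2 + c\<^sup>2)"

definition mu_inf :: "real \<Rightarrow> ereal \<Rightarrow> real" where
  "mu_inf a c = (if c = \<infinity> then 0 else mu a (real_of_ereal c))"

definition vartheta :: "real \<Rightarrow> (nat \<Rightarrow> real) \<Rightarrow> (nat \<Rightarrow> real) \<Rightarrow> nat \<Rightarrow> real" where
  "vartheta a c \<delta> k = (mu a (c k) + \<delta> k) / (1 - \<delta> k)"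

end

theory Submission
  imports Defs
begin

text \<open>
  Minty's theorem: with \<open>w = z - c v\<close>, solving \<open>z \<in> x + c T x\<close> means finding a point \<open>x\<close>
  with \<open>(x - y) \<bullet> (x - w) \<le> 0\<close> for all \<open>v \<in> T y\<close>, i.e. a common point of balls with centres
  \<open>(y + w) / 2\<close>. Such a point is the limit of the first components of a minimising sequence of
  \<open>(x, l) \<mapsto> \<parallel>x\<parallel>\<^sup>2 - l\<close> on the convex hull of the points \<open>((y + w) / 2, y \<bullet> w)\<close>; monotonicity
  makes this function nonnegative there.

  Convergence: on bounded sets, the Lipschitz condition and
  \<open>\<parallel>P z - zs\<parallel>\<^sup>2 + \<parallel>z - P z\<parallel>\<^sup>2 \<le> \<parallel>z - zs\<parallel>\<^sup>2\<close> make all proximal maps with parameter bounded below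
  contract towards the zero \<open>zs\<close> by a common factor \<open>\<rho> < 1\<close>. Hence \<open>\<parallel>z\<^sup>k - zs\<parallel>\<close> is
  contracted up to perturbations tending to zero. Once the residuals are small, the same two
  inequalities give the factor \<open>\<mu>\<^sub>k\<close>.
\<close>

section \<open>Convex minimisation and Minty's theorem\<close>

text \<open>The function \<open>(norm x)\<^sup>2 - l\<close> is uniformly convex in
  \<open>x\<close>, so minimising sequences are Cauchy in \<open>x\<close> although \<open>K\<close>
  need not be closed. First-order optimality at the limit bounds the left side by
  \<open>- I\<close>, where \<open>I \<ge> 0\<close> is the infimum.\<close>

lemma convex_quadratic_minimizer:
  fixes K :: "('a::{real_inner, complete_space} \<times> real) set"
  assumes K: "convex K" "K \<noteq> {}" and le: "\<And>x l. (x, l) \<in> K \<Longrightarrow> l \<le> (norm x)\<^sup>2"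
  obtains x0 where "\<And>x l. (x, l) \<in> K \<Longrightarrow> (norm x0)\<^sup>2 - 2 * (x0 \<bullet> x) + l \<le> 0"
proof -
  define h where "h k = (norm (fst k))\<^sup>2 - snd k" for k :: "'a \<times> real"
  define I where "I = Inf (h ` K)"
  have h0: "h k \<ge> 0" if "k \<in> K" for k
    using le[of "fst k" "snd k"] that by (simp add: h_def)
  have bdd: "bdd_below (h ` K)"
    using h0 by (intro bdd_belowI[of _ 0]) auto
  have I_le: "I \<le> h k" if "k \<in> K" for k
    unfolding I_def using bdd that by (intro cInf_lower) auto
  have I0: "I \<ge> 0"
    unfolding I_def using K h0 by (intro cInf_greatest) auto
  have "\<exists>k\<in>K. h k < I + 1 / real (Suc n)" for n
    using cInf_lessD[of "h ` K" "I + 1 / real (Suc n)"] K by (auto simp: I_def)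
  then obtain k where kK: "\<And>n. k n \<in> K" and kI: "\<And>n. h (k n) < I + 1 / real (Suc n)"
    by metis
  define x where "x n = fst (k n)" for n
  have h_lim: "(\<lambda>n. h (k n)) \<longlonglongrightarrow> I"
  proof (rule tendsto_sandwich[of "\<lambda>_. I" _ _ "\<lambda>n. I + 1 / real (Suc n)"])
    show "(\<lambda>n. I + 1 / real (Suc n)) \<longlonglongrightarrow> I"
      using tendsto_add[OF tendsto_const LIMSEQ_inverse_real_of_nat, of I]
      by (simp add: inverse_eq_divide)
    show "\<forall>\<^sub>F n in sequentially. I \<le> h (k n)"
      by (intro always_eventually allI I_le kK)
    show "\<forall>\<^sub>F n in sequentially. h (k n) \<le> I + 1 / real (Suc n)"
      using kI less_imp_le by (intro always_eventually allI) blast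
  qed (rule tendsto_const)
  \<comment> \<open>Compare with the midpoint, which stays in \<open>K\<close>: by the parallelogram
    identity its value lies below the mean of the two values by a quarter of the squared
    distance.\<close>
  have dist_sq: "(norm (x m - x n))\<^sup>2 \<le> 2 * ((h (k m) - I) + (h (k n) - I))" for m n
  proof -
    have "(1/2) *\<^sub>R k m + (1/2) *\<^sub>R k n \<in> K"
      using K(1) kK by (intro convexD) auto
    from I_le[OF this] have "I \<le> h ((1/2) *\<^sub>R k m + (1/2) *\<^sub>R k n)" .
    also have "\<dots> = (h (k m) + h (k n)) / 2 - (norm (x m - x n))\<^sup>2 / 4"
      unfolding h_def x_def power2_norm_eq_inner
      by (simp add: inner_simps inner_commute field_simps)
    finally show ?thesis by (simp add: field_simps)
  qed
  have "Cauchy x"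
  proof (rule CauchyI)
    fix e :: real assume e: "e > 0"
    have "\<forall>\<^sub>F n in sequentially. h (k n) < I + e\<^sup>2 / 4"
      using h_lim e by (intro order_tendstoD) auto
    then obtain N where N: "\<And>n. n \<ge> N \<Longrightarrow> h (k n) < I + e\<^sup>2 / 4"
      by (auto simp: eventually_sequentially)
    have "norm (x m - x n) < e" if "m \<ge> N" "n \<ge> N" for m n
    proof (rule power2_less_imp_less)
      show "(norm (x m - x n))\<^sup>2 < e\<^sup>2"
        using dist_sq[of m n] N[OF that(1)] N[OF that(2)] by (simp add: field_simps)
    qed (use e in simp)
    then show "\<exists>N. \<forall>m\<ge>N. \<forall>n\<ge>N. norm (x m - x n) < e" by blast
  qed
  then obtain x0 where x0: "x \<longlonglongrightarrow> x0"
    using Cauchy_convergent convergent_def by blast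
  have "(norm x0)\<^sup>2 - 2 * (x0 \<bullet> y) + l \<le> 0" if yl: "(y, l) \<in> K" for y l
  proof -
    \<comment> \<open>One-sided derivative of \<open>h\<close> at the limit point
      \<open>(x0, (norm x0)\<^sup>2 - I)\<close> towards \<open>(y, l)\<close>.\<close>
    define A where "A = 2 * (x0 \<bullet> (y - x0)) + (norm x0)\<^sup>2 - I - l"
    have A: "0 \<le> A + t * (norm (y - x0))\<^sup>2" if t: "0 < t" "t < 1" for t
    proof -
      \<comment> \<open>This is \<open>h - I \<ge> 0\<close> on the segment from \<open>k n\<close>
        to \<open>(y, l)\<close>, with \<open>snd (k n)\<close> rewritten as
        \<open>(norm (x n))\<^sup>2 - h (k n)\<close> so that the limit in \<open>n\<close> only
        needs those of \<open>x n\<close> and \<open>h (k n)\<close>.\<close>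
      have "0 \<le> (h (k n) - I) + 2 * t * (x n \<bullet> (y - x n)) + t\<^sup>2 * (norm (y - x n))\<^sup>2
              + t * ((norm (x n))\<^sup>2 - h (k n)) - t * l" for n
      proof -
        have "(1 - t) *\<^sub>R k n + t *\<^sub>R (y, l) \<in> K"
          using K(1) kK yl t by (intro convexD) auto
        from I_le[OF this] show ?thesis
          unfolding h_def x_def power2_norm_eq_inner
          by (simp add: inner_simps inner_commute algebra_simps power2_eq_square)
      qed
      moreover have "(\<lambda>n. (h (k n) - I) + 2 * t * (x n \<bullet> (y - x n)) + t\<^sup>2 * (norm (y - x n))\<^sup>2
              + t * ((norm (x n))\<^sup>2 - h (k n)) - t * l) \<longlonglongrightarrow>
            (I - I) + 2 * t * (x0 \<bullet> (y - x0)) + t\<^sup>2 * (norm (y - x0))\<^sup>2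
              + t * ((norm x0)\<^sup>2 - I) - t * l"
        by (intro tendsto_intros h_lim x0)
      ultimately have "0 \<le> (I - I) + 2 * t * (x0 \<bullet> (y - x0)) + t\<^sup>2 * (norm (y - x0))\<^sup>2
              + t * ((norm x0)\<^sup>2 - I) - t * l"
        by (intro LIMSEQ_le_const) auto
      also have "\<dots> = t * (A + t * (norm (y - x0))\<^sup>2)"
        by (simp add: A_def algebra_simps power2_eq_square)
      finally show ?thesis using t by (simp add: zero_le_mult_iff)
    qed
    have "((\<lambda>t. A + t * (norm (y - x0))\<^sup>2) \<longlongrightarrow> A + 0 * (norm (y - x0))\<^sup>2) (at_right 0)"
      by (intro tendsto_intros)
    moreover have "\<forall>\<^sub>F t in at_right 0. 0 \<le> A + t * (norm (y - x0))\<^sup>2"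
      using A by (auto simp: eventually_at_right_field intro!: exI[of _ 1])
    ultimately have "0 \<le> A"
      using tendsto_lowerbound trivial_limit_at_right_real by fastforce
    then show ?thesis
      using I0 by (simp add: A_def inner_simps power2_norm_eq_inner)
  qed
  then show thesis by (rule that)
qed

text \<open>The conclusion places \<open>x\<close> in the ball with diameter from \<open>y\<close>
  to \<open>w\<close>. Expanded, it is the optimality inequality of
  \<open>convex_quadratic_minimizer\<close> at the midpoint of \<open>y\<close> and \<open>w\<close>
  with \<open>l = y \<bullet> w\<close>.\<close>

lemma antimonotone_ball_intersection:
  fixes G :: "('a::{real_inner, complete_space} \<times> 'a) set"
  assumes mono: "\<And>y w y' w'. (y, w) \<in> G \<Longrightarrow> (y', w') \<in> G \<Longrightarrow> (y - y') \<bullet> (w - w') \<le> 0"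
  obtains x where "\<And>y w. (y, w) \<in> G \<Longrightarrow> (x - y) \<bullet> (x - w) \<le> 0"
proof (cases "G = {}")
  case True
  then show thesis using that by auto
next
  case False
  \<comment> \<open>The hull is taken with \<open>y\<close> and \<open>w\<close> kept apart, since
    the polarised inequality needs both; \<open>f\<close> passes to midpoints only
    afterwards.\<close>
  define E where "E = (\<lambda>(y, w). (y, w, y \<bullet> w)) ` G"
  define f where "f = (\<lambda>(p::'a, q::'a, l::real). ((1/2) *\<^sub>R (p + q), l))"
  have lin: "linear f"
    by (intro linearI) (auto simp: f_def algebra_simps)
  text \<open>Polarised form of \<open>l \<le> p \<bullet> q\<close>: affine in each of the two points, so that it passes
    to the convex hull.\<close>
  have step: "l + l' \<le> p \<bullet> q' + p' \<bullet> q"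
    if "(p, q, l) \<in> convex hull E" "(p', q', l') \<in> E" for p q l p' q' l'
  proof -
    have "convex {(p, q, l). l + l' \<le> p \<bullet> q' + p' \<bullet> q}"
    proof (rule convexI, clarsimp)
      fix p1 q1 l1 p2 q2 l2 and u v :: real
      assume *: "l1 + l' \<le> p1 \<bullet> q' + p' \<bullet> q1" "l2 + l' \<le> p2 \<bullet> q' + p' \<bullet> q2"
        "0 \<le> u" "0 \<le> v" "u + v = 1"
      have "u * (l1 + l') + v * (l2 + l') \<le> u * (p1 \<bullet> q' + p' \<bullet> q1) + v * (p2 \<bullet> q' + p' \<bullet> q2)"
        by (rule add_mono; rule mult_left_mono) (use * in auto)
      moreover have "u * (l1 + l') + v * (l2 + l') = u * l1 + v * l2 + (u + v) * l'"
        by (simp add: algebra_simps)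
      ultimately show "u * l1 + v * l2 + l' \<le>
          (u *\<^sub>R p1 + v *\<^sub>R p2) \<bullet> q' + p' \<bullet> (u *\<^sub>R q1 + v *\<^sub>R q2)"
        using \<open>u + v = 1\<close> by (simp add: inner_simps algebra_simps)
    qed
    moreover have "E \<subseteq> {(p, q, l). l + l' \<le> p \<bullet> q' + p' \<bullet> q}"
    proof
      fix e assume "e \<in> E"
      then obtain y w where e: "e = (y, w, y \<bullet> w)" "(y, w) \<in> G" by (auto simp: E_def)
      from that(2) have "(p', q') \<in> G" "l' = p' \<bullet> q'" by (auto simp: E_def)
      with mono[OF e(2)] show "e \<in> {(p, q, l). l + l' \<le> p \<bullet> q' + p' \<bullet> q}"
        by (simp add: e inner_simps algebra_simps)
    qed
    ultimately have "convex hull E \<subseteq> {(p, q, l). l + l' \<le> p \<bullet> q' + p' \<bullet> q}"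
      by (rule hull_minimal[rotated])
    with that(1) show ?thesis by auto
  qed
  \<comment> \<open>Now the second point ranges over the hull as well; taking both points equal will
    give \<open>l \<le> p \<bullet> q\<close>.\<close>
  have step2: "l + l' \<le> p \<bullet> q' + p' \<bullet> q"
    if "(p, q, l) \<in> convex hull E" "(p', q', l') \<in> convex hull E" for p q l p' q' l'
  proof -
    have "convex {(p', q', l'). l + l' \<le> p \<bullet> q' + p' \<bullet> q}"
    proof (rule convexI, clarsimp)
      fix p1 q1 l1 p2 q2 l2 and u v :: real
      assume *: "l + l1 \<le> p \<bullet> q1 + p1 \<bullet> q" "l + l2 \<le> p \<bullet> q2 + p2 \<bullet> q"
        "0 \<le> u" "0 \<le> v" "u + v = 1"
      have "u * (l + l1) + v * (l + l2) \<le> u * (p \<bullet> q1 + p1 \<bullet> q) + v * (p \<bullet> q2 + p2 \<bullet> q)"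
        by (rule add_mono; rule mult_left_mono) (use * in auto)
      moreover have "u * (l + l1) + v * (l + l2) = u * l1 + v * l2 + (u + v) * l"
        by (simp add: algebra_simps)
      ultimately show "l + (u * l1 + v * l2) \<le>
          p \<bullet> (u *\<^sub>R q1 + v *\<^sub>R q2) + (u *\<^sub>R p1 + v *\<^sub>R p2) \<bullet> q"
        using \<open>u + v = 1\<close> by (simp add: inner_simps algebra_simps)
    qed
    moreover have "E \<subseteq> {(p', q', l'). l + l' \<le> p \<bullet> q' + p' \<bullet> q}"
      using step[OF that(1)] by auto
    ultimately have "convex hull E \<subseteq> {(p', q', l'). l + l' \<le> p \<bullet> q' + p' \<bullet> q}"
      by (rule hull_minimal[rotated])
    with that(2) show ?thesis by auto
  qed
  have "convex (f ` (convex hull E))"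
    by (intro convex_linear_image lin convex_convex_hull)
  moreover have "f ` (convex hull E) \<noteq> {}"
    using False by (simp add: E_def)
  moreover have "l \<le> (norm x)\<^sup>2" if "(x, l) \<in> f ` (convex hull E)" for x l
  proof -
    from that obtain p q where pq: "(p, q, l) \<in> convex hull E" "x = (1/2) *\<^sub>R (p + q)"
      by (auto simp: f_def)
    have "l \<le> p \<bullet> q" using step2[OF pq(1) pq(1)] by simp
    \<comment> \<open>A quarter of this square is
      \<open>(norm x)\<^sup>2 - p \<bullet> q\<close>.\<close>
    moreover have "0 \<le> (norm (p - q))\<^sup>2" by simp
    then have "p \<bullet> q \<le> (norm x)\<^sup>2"
      unfolding power2_norm_eq_inner pq by (simp add: inner_simps inner_commute field_simps)
    ultimately show ?thesis by simp
  qed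
  ultimately obtain x where
    x: "\<And>m l. (m, l) \<in> f ` (convex hull E) \<Longrightarrow> (norm x)\<^sup>2 - 2 * (x \<bullet> m) + l \<le> 0"
    using convex_quadratic_minimizer by blast
  have "(x - y) \<bullet> (x - w) \<le> 0" if "(y, w) \<in> G" for y w
  proof -
    have "(y, w, y \<bullet> w) \<in> convex hull E"
      using that by (intro hull_inc) (auto simp: E_def)
    then have "((1/2) *\<^sub>R (y + w), y \<bullet> w) \<in> f ` (convex hull E)"
      by (force simp: f_def)
    from x[OF this] show ?thesis
      by (simp add: power2_norm_eq_inner inner_simps inner_commute field_simps)
  qed
  then show thesis by (rule that)
qed

text \<open>Adjoining the pair \<open>(x, u)\<close> to the graph keeps it monotone, so by
  maximality the pair was already there.\<close>

lemma maximal_monotoneD: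
  assumes T: "maximal_monotone T"
    and uT: "\<And>y v. v \<in> T y \<Longrightarrow> 0 \<le> (x - y) \<bullet> (u - v)"
  shows "u \<in> T x"
proof -
  define S where "S = T(x := insert u (T x))"
  have mono: "monotone_operator T"
    using T by (simp add: maximal_monotone_def)
  have sym: "(y - x) \<bullet> (v - u) = (x - y) \<bullet> (u - v)" for y v
    by (simp add: inner_simps)
  have "monotone_operator S"
    unfolding monotone_operator_def
  proof (intro allI impI)
    fix p q r s assume "r \<in> S p" "s \<in> S q"
    then consider "r \<in> T p" "s \<in> T q" | "p = x" "r = u" "s \<in> T q"
      | "q = x" "s = u" "r \<in> T p" | "p = x" "q = x" "r = u" "s = u"
      by (auto simp: S_def split: if_splits)
    then show "0 \<le> (p - q) \<bullet> (r - s)"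
      using mono uT sym by cases (auto simp: monotone_operator_def)
  qed
  moreover have "\<forall>y. T y \<subseteq> S y" by (auto simp: S_def)
  ultimately have "S = T" using T unfolding maximal_monotone_def by blast
  then have "S x = T x" by simp
  then show ?thesis by (auto simp: S_def)
qed

text \<open>The map \<open>v \<mapsto> z - c v\<close> reverses monotonicity, which yields a common
  point \<open>x\<close> of the balls. Up to the factor \<open>1 / c\<close>, the ball inequalities
  say that \<open>x\<close> and \<open>(1 / c) *\<^sub>R (z - x)\<close> are monotonically related
  to the whole graph.\<close>

theorem minty:
  fixes T :: "'a::{real_inner, complete_space} \<Rightarrow> 'a set"
  assumes T: "maximal_monotone T" and c: "c > 0"
  obtains x where "(1 / c) *\<^sub>R (z - x) \<in> T x"
proof -
  have mono: "0 \<le> (y - y') \<bullet> (v - v')" if "v \<in> T y" "v' \<in> T y'" for y y' v v'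
    using T that by (auto simp: maximal_monotone_def monotone_operator_def)
  define G where "G = {(y, z - c *\<^sub>R v) | y v. v \<in> T y}"
  have "(y - y') \<bullet> (w - w') \<le> 0" if G: "(y, w) \<in> G" "(y', w') \<in> G" for y w y' w'
  proof -
    from G obtain v v' where v: "v \<in> T y" "w = z - c *\<^sub>R v" "v' \<in> T y'" "w' = z - c *\<^sub>R v'"
      by (auto simp: G_def)
    have "(y - y') \<bullet> (w - w') = - (c * ((y - y') \<bullet> (v - v')))"
      by (simp add: v inner_simps algebra_simps)
    then show ?thesis using mono[OF v(1,3)] c by simp
  qed
  then obtain x where x: "\<And>y w. (y, w) \<in> G \<Longrightarrow> (x - y) \<bullet> (x - w) \<le> 0"
    using antimonotone_ball_intersection by blast
  have "(1 / c) *\<^sub>R (z - x) \<in> T x"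
  proof (rule maximal_monotoneD[OF T])
    fix y v assume "v \<in> T y"
    then have "(x - y) \<bullet> (x - (z - c *\<^sub>R v)) \<le> 0"
      by (intro x) (auto simp: G_def)
    moreover have "(x - y) \<bullet> ((1 / c) *\<^sub>R (z - x) - v) = - ((x - y) \<bullet> (x - (z - c *\<^sub>R v))) / c"
      using c by (simp add: inner_simps field_simps)
    ultimately show "0 \<le> (x - y) \<bullet> ((1 / c) *\<^sub>R (z - x) - v)"
      using c by (simp add: divide_le_0_iff)
  qed
  then show thesis by (rule that)
qed

section \<open>The proximal map\<close>

lemma resolvent_iff:
  assumes "c > 0"
  shows "x \<in> resolvent T c z \<longleftrightarrow> (1 / c) *\<^sub>R (z - x) \<in> T x"
proof
  assume "x \<in> resolvent T c z"
  then show "(1 / c) *\<^sub>R (z - x) \<in> T x"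
    using assms by (auto simp: resolvent_def inverse_operator_def)
next
  assume "(1 / c) *\<^sub>R (z - x) \<in> T x"
  moreover have "z = x + c *\<^sub>R ((1 / c) *\<^sub>R (z - x))" using assms by simp
  ultimately show "x \<in> resolvent T c z"
    unfolding resolvent_def inverse_operator_def by blast
qed

text \<open>Makes the definite description in \<open>prox_map\<close> usable: existence is Minty's
  theorem, and for two candidates monotonicity gives
  \<open>- (norm (x - y))\<^sup>2 / c \<ge> 0\<close>, hence uniqueness.\<close>

lemma prox_map_in:
  fixes T :: "'a::{real_inner, complete_space} \<Rightarrow> 'a set"
  assumes T: "maximal_monotone T" and c: "c > 0"
  shows "(1 / c) *\<^sub>R (z - prox_map T c z) \<in> T (prox_map T c z)"
proof -
  have "\<exists>!x. x \<in> resolvent T c z"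
  proof (rule ex_ex1I)
    show "\<exists>x. x \<in> resolvent T c z"
      using minty[OF T c] resolvent_iff[OF c] by metis
  next
    fix x y assume "x \<in> resolvent T c z" "y \<in> resolvent T c z"
    then have "(1 / c) *\<^sub>R (z - x) \<in> T x" "(1 / c) *\<^sub>R (z - y) \<in> T y"
      by (simp_all only: resolvent_iff[OF c])
    then have "0 \<le> (x - y) \<bullet> ((1 / c) *\<^sub>R (z - x) - (1 / c) *\<^sub>R (z - y))"
      using T unfolding maximal_monotone_def monotone_operator_def by blast
    also have "(1 / c) *\<^sub>R (z - x) - (1 / c) *\<^sub>R (z - y) = (- 1 / c) *\<^sub>R (x - y)"
      by (simp add: algebra_simps)
    finally have "(x - y) \<bullet> (x - y) \<le> 0"
      using c by (simp add: divide_le_0_iff)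
    then show "x = y"
      by (metis inner_gt_zero_iff linorder_not_le right_minus_eq)
  qed
  from theI'[OF this] show ?thesis
    unfolding prox_map_def by (simp only: resolvent_iff[OF c])
qed

text \<open>Monotonicity between the proximal point and the zero \<open>zs\<close> makes the cross
  term nonnegative when \<open>z - zs\<close> is split at the proximal point.\<close>

lemma prox_map_pythagoras:
  fixes T :: "'a::{real_inner, complete_space} \<Rightarrow> 'a set"
  assumes T: "maximal_monotone T" and c: "c > 0" and zs: "0 \<in> T zs"
  shows "(norm (prox_map T c z - zs))\<^sup>2 + (norm (z - prox_map T c z))\<^sup>2 \<le> (norm (z - zs))\<^sup>2"
proof -
  let ?p = "prox_map T c z"
  have "0 \<le> (?p - zs) \<bullet> ((1 / c) *\<^sub>R (z - ?p) - 0)"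
    using T prox_map_in[OF T c] zs unfolding maximal_monotone_def monotone_operator_def by blast
  then have "0 \<le> (?p - zs) \<bullet> (z - ?p)"
    using c by (simp add: zero_le_divide_iff)
  then show ?thesis
    unfolding power2_norm_eq_inner by (simp add: inner_simps inner_commute algebra_simps)
qed

section \<open>Contraction estimates\<close>

text \<open>Once \<open>\<tau> k\<close> is below \<open>(1 - \<rho>) * (e / 2)\<close>, the
  recursion is dominated by an affine map with fixed point \<open>e / 2\<close>, and any excess over
  \<open>e / 2\<close> decays like \<open>\<rho> ^ n\<close>.\<close>

lemma perturbed_contraction_tendsto_0:
  fixes v \<tau> :: "nat \<Rightarrow> real"
  assumes v: "\<And>k. 0 \<le> v k" and \<rho>: "0 \<le> \<rho>" "\<rho> < 1" and \<tau>: "\<tau> \<longlonglongrightarrow> 0"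
    and step: "\<forall>\<^sub>F k in sequentially. v (Suc k) \<le> \<rho> * v k + \<tau> k"
  shows "v \<longlonglongrightarrow> 0"
proof (rule LIMSEQ_I)
  fix e :: real assume e: "e > 0"
  have "\<forall>\<^sub>F k in sequentially. \<tau> k < (1 - \<rho>) * (e / 2)"
    using \<tau> \<rho> e by (intro order_tendstoD) auto
  with step have "\<forall>\<^sub>F k in sequentially. v (Suc k) \<le> \<rho> * v k + (1 - \<rho>) * (e / 2)"
    by eventually_elim linarith
  then obtain N where N: "\<And>k. k \<ge> N \<Longrightarrow> v (Suc k) \<le> \<rho> * v k + (1 - \<rho>) * (e / 2)"
    by (auto simp: eventually_sequentially)
  have bound: "v (n + N) \<le> \<rho> ^ n * v N + e / 2" for n
  proof (induction n)
    case 0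
    then show ?case using e by simp
  next
    case (Suc n)
    have "v (Suc n + N) \<le> \<rho> * v (n + N) + (1 - \<rho>) * (e / 2)"
      using N[of "n + N"] by simp
    also have "\<dots> \<le> \<rho> * (\<rho> ^ n * v N + e / 2) + (1 - \<rho>) * (e / 2)"
      using Suc \<rho> by (intro add_right_mono mult_left_mono) auto
    also have "\<dots> = \<rho> ^ Suc n * v N + e / 2"
      by (simp add: field_simps)
    finally show ?case .
  qed
  have "(\<lambda>n. \<rho> ^ n * v N) \<longlonglongrightarrow> 0 * v N"
    using \<rho> by (intro tendsto_intros LIMSEQ_realpow_zero) auto
  then have "\<forall>\<^sub>F n in sequentially. \<rho> ^ n * v N < e / 2"
    using e by (intro order_tendstoD) auto
  then obtain M where "\<And>n. n \<ge> M \<Longrightarrow> \<rho> ^ n * v N < e / 2"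
    by (auto simp: eventually_sequentially)
  then have "v (n + N) < e" if "n \<ge> M" for n
    using bound[of n] that by (smt (verit) field_sum_of_halves)
  then have "norm (v n - 0) < e" if "n \<ge> M + N" for n
    using that v[of n] by (metis (no_types, opaque_lifting) abs_of_nonneg diff_zero
      le_add_diff_inverse2 add_le_imp_le_right le_add2 le_trans real_norm_def)
  then show "\<exists>no. \<forall>n\<ge>no. norm (v n - 0) < e" by blast
qed

text \<open>Serves while \<open>z\<close> is only known to be bounded, when the residual may still
  exceed \<open>\<epsilon>\<close>. The proximal step is at least
  \<open>\<beta> * norm (z - zs)\<close>, and \<open>prox_map_pythagoras\<close> turns this into the
  factor \<open>sqrt (1 - \<beta>\<^sup>2)\<close>.\<close>

lemma prox_map_uniform_contraction:
  fixes T :: "'a::{real_inner, complete_space} \<Rightarrow> 'a set"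
  assumes T: "maximal_monotone T" and zs: "0 \<in> T zs" and a: "a \<ge> 0" and \<epsilon>: "\<epsilon> > 0" and c0: "c0 > 0"
    and lip: "\<And>w x. w \<in> T x \<Longrightarrow> norm w \<le> \<epsilon> \<Longrightarrow> norm (x - zs) \<le> a * norm w"
  obtains \<rho> where "0 \<le> \<rho>" "\<rho> < 1"
    "\<And>c z. c0 \<le> c \<Longrightarrow> norm (z - zs) \<le> M \<Longrightarrow> norm (prox_map T c z - zs) \<le> \<rho> * norm (z - zs)"
proof -
  \<comment> \<open>The first entry serves steps of length at most \<open>c0 * \<epsilon>\<close>,
    the second longer ones. The denominator \<open>\<bar>M\<bar> + c0 * \<epsilon>\<close> is
    positive for every \<open>M\<close> and dominates \<open>norm (z - zs)\<close>.\<close>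
  define \<beta> where "\<beta> = min (1 / (1 + a / c0)) (c0 * \<epsilon> / (\<bar>M\<bar> + c0 * \<epsilon>))"
  have pos: "0 < 1 + a / c0" "0 < c0 * \<epsilon>" "0 < \<bar>M\<bar> + c0 * \<epsilon>"
    using a c0 \<epsilon> by (auto intro: add_pos_nonneg add_nonneg_pos)
  have \<beta>: "0 < \<beta>" "\<beta> \<le> 1 / (1 + a / c0)" "\<beta> \<le> c0 * \<epsilon> / (\<bar>M\<bar> + c0 * \<epsilon>)"
    using pos by (auto simp: \<beta>_def)
  have "1 / (1 + a / c0) \<le> 1" using a c0 pos(1) by (simp add: pos_divide_le_eq)
  with \<beta> have \<beta>1: "\<beta> \<le> 1" by linarith
  then have \<beta>sq: "0 < \<beta>\<^sup>2" "\<beta>\<^sup>2 \<le> 1" using \<beta> by (auto simp: power_le_one)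
  have "norm (prox_map T c z - zs) \<le> sqrt (1 - \<beta>\<^sup>2) * norm (z - zs)"
    if c: "c0 \<le> c" and M: "norm (z - zs) \<le> M" for c z
  proof -
    define p where "p = prox_map T c z"
    have c': "c > 0" using c c0 by simp
    have pyth: "(norm (p - zs))\<^sup>2 + (norm (z - p))\<^sup>2 \<le> (norm (z - zs))\<^sup>2"
      unfolding p_def by (rule prox_map_pythagoras[OF T c' zs])
    have \<beta>le: "\<beta> * norm (z - zs) \<le> norm (z - p)"
    \<comment> \<open>A short step has residual \<open>(z - p) / c\<close> of norm at most
      \<open>\<epsilon>\<close>, so \<open>lip\<close> applies; a long step is compared with the
      bound \<open>M\<close>.\<close>
    proof (cases "norm (z - p) \<le> c0 * \<epsilon>")
      case True
      have nw: "norm ((1 / c) *\<^sub>R (z - p)) = norm (z - p) / c" using c' by simp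
      also have le: "norm (z - p) / c \<le> norm (z - p) / c0"
        using c c0 by (intro divide_left_mono) auto
      also have "\<dots> \<le> \<epsilon>" using True c0 by (simp add: field_simps)
      finally have "norm (p - zs) \<le> a * norm ((1 / c) *\<^sub>R (z - p))"
        by (rule lip[OF prox_map_in[OF T c', of z, folded p_def]])
      also have "\<dots> = a * (norm (z - p) / c)" by (simp only: nw)
      also have "\<dots> \<le> a * (norm (z - p) / c0)" using a le by (rule mult_left_mono[rotated])
      finally have "norm (z - zs) \<le> norm (z - p) * (1 + a / c0)"
        using norm_triangle_ineq[of "z - p" "p - zs"] by (simp add: algebra_simps)
      then have "norm (z - zs) / (1 + a / c0) \<le> norm (z - p)"
        using pos by (simp add: pos_divide_le_eq)
      moreover have "\<beta> * norm (z - zs) \<le> (1 / (1 + a / c0)) * norm (z - zs)"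
        using \<beta> by (intro mult_right_mono) auto
      ultimately show ?thesis by simp
    next
      case False
      have "\<beta> * norm (z - zs) \<le> c0 * \<epsilon> / (\<bar>M\<bar> + c0 * \<epsilon>) * (\<bar>M\<bar> + c0 * \<epsilon>)"
        using \<beta> pos M by (intro mult_mono) auto
      also have "\<dots> = c0 * \<epsilon>" using pos by simp
      finally show ?thesis using False by simp
    qed
    have "(\<beta> * norm (z - zs))\<^sup>2 \<le> (norm (z - p))\<^sup>2"
      using \<beta>le \<beta> by (intro power_mono) auto
    with pyth have "(norm (p - zs))\<^sup>2 \<le> (1 - \<beta>\<^sup>2) * (norm (z - zs))\<^sup>2"
      by (simp add: power_mult_distrib algebra_simps)
    also have "\<dots> = (sqrt (1 - \<beta>\<^sup>2) * norm (z - zs))\<^sup>2"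
      using \<beta>sq by (simp add: power_mult_distrib)
    finally show ?thesis
      unfolding p_def by (rule power2_le_imp_le) (use \<beta>sq in auto)
  qed
  moreover have "0 \<le> sqrt (1 - \<beta>\<^sup>2)" "sqrt (1 - \<beta>\<^sup>2) < 1"
    using \<beta>sq by auto
  ultimately show thesis using that by blast
qed

text \<open>The step is no longer than \<open>norm (z - zs)\<close>, so \<open>small\<close> puts
  the residual in the range of \<open>lip\<close>, giving
  \<open>c * norm (p - zs) \<le> a * norm (z - p)\<close>. Squaring and adding
  \<open>a\<^sup>2\<close> times the Pythagorean inequality eliminates
  \<open>norm (z - p)\<close>.\<close>

lemma prox_map_mu_contraction:
  fixes T :: "'a::{real_inner, complete_space} \<Rightarrow> 'a set"
  assumes T: "maximal_monotone T" and zs: "0 \<in> T zs" and a: "a \<ge> 0" and c: "c > 0"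
    and lip: "\<And>w x. w \<in> T x \<Longrightarrow> norm w \<le> \<epsilon> \<Longrightarrow> norm (x - zs) \<le> a * norm w"
    and small: "norm (z - zs) \<le> c * \<epsilon>"
  shows "norm (prox_map T c z - zs) \<le> mu a c * norm (z - zs)"
proof -
  define p where "p = prox_map T c z"
  have pyth: "(norm (p - zs))\<^sup>2 + (norm (z - p))\<^sup>2 \<le> (norm (z - zs))\<^sup>2"
    unfolding p_def by (rule prox_map_pythagoras[OF T c zs])
  then have "(norm (z - p))\<^sup>2 \<le> (norm (z - zs))\<^sup>2"
    using zero_le_power2[of "norm (p - zs)"] by linarith
  then have "norm (z - p) \<le> norm (z - zs)" by (rule power2_le_imp_le) simp
  with small have "norm (z - p) / c \<le> \<epsilon>"
    using c by (simp add: pos_divide_le_eq mult.commute)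
  moreover have "norm ((1 / c) *\<^sub>R (z - p)) = norm (z - p) / c" using c by simp
  ultimately have "norm (p - zs) \<le> a * (norm (z - p) / c)"
    using lip[OF prox_map_in[OF T c, of z, folded p_def]] by metis
  then have "c * norm (p - zs) \<le> a * norm (z - p)"
    using c by (simp add: pos_le_divide_eq mult.commute)
  then have "(c * norm (p - zs))\<^sup>2 \<le> (a * norm (z - p))\<^sup>2"
    using c by (intro power_mono) auto
  moreover have "a\<^sup>2 * ((norm (p - zs))\<^sup>2 + (norm (z - p))\<^sup>2) \<le> a\<^sup>2 * (norm (z - zs))\<^sup>2"
    using pyth by (intro mult_left_mono) auto
  ultimately have "(sqrt (a\<^sup>2 + c\<^sup>2) * norm (p - zs))\<^sup>2 \<le> (a * norm (z - zs))\<^sup>2"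
    by (simp add: power_mult_distrib algebra_simps)
  then have "sqrt (a\<^sup>2 + c\<^sup>2) * norm (p - zs) \<le> a * norm (z - zs)"
    by (rule power2_le_imp_le) (use a in auto)
  moreover have "0 < a\<^sup>2 + c\<^sup>2" using c by (simp add: add_nonneg_pos)
  ultimately show ?thesis
    unfolding mu_def p_def by (simp add: field_simps)
qed

section \<open>The factor \<open>mu\<close> and its limit\<close>

lemma mu_nonneg: "a \<ge> 0 \<Longrightarrow> 0 \<le> mu a c"
  by (simp add: mu_def)

lemma mu_less_1:
  assumes "a \<ge> 0" "c > 0"
  shows "mu a c < 1"
proof -
  have "0 < c\<^sup>2" using assms by simp
  then have "a < sqrt (a\<^sup>2 + c\<^sup>2)"
    by (intro real_less_rsqrt) simp
  moreover from this have "0 < sqrt (a\<^sup>2 + c\<^sup>2)" using assms by linarith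
  ultimately show ?thesis unfolding mu_def by (simp add: pos_divide_less_eq)
qed

lemma mu_antimono:
  assumes "a \<ge> 0" "0 < c" "c \<le> c'"
  shows "mu a c' \<le> mu a c"
proof -
  have "c\<^sup>2 \<le> c'\<^sup>2" using assms by (intro power_mono) auto
  moreover have "0 < c\<^sup>2" "0 < c'\<^sup>2" using assms by auto
  ultimately show ?thesis
    unfolding mu_def using assms
    by (intro divide_left_mono mult_pos_pos) (auto intro: add_nonneg_pos)
qed

lemma mu_tendsto_mu_inf:
  assumes "a \<ge> 0" and pos: "\<forall>k. 0 < c k" and "incseq c" and lim: "(\<lambda>k. ereal (c k)) \<longlonglongrightarrow> c_inf"
  shows "(\<lambda>k. mu a (c k)) \<longlonglongrightarrow> mu_inf a c_inf"
proof (cases c_inf)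
  case (real r)
  have "c \<longlonglongrightarrow> r" using lim real by simp
  \<comment> \<open>The limit is at least \<open>c 0\<close>, so the denominator stays nonzero even
    for \<open>a = 0\<close>.\<close>
  moreover have "r > 0"
    using incseq_le[OF \<open>incseq c\<close> \<open>c \<longlonglongrightarrow> r\<close>, of 0] pos by (meson less_le_trans)
  then have "a\<^sup>2 + r\<^sup>2 > 0" by (simp add: add_nonneg_pos)
  ultimately have "(\<lambda>k. a / sqrt (a\<^sup>2 + (c k)\<^sup>2)) \<longlonglongrightarrow> a / sqrt (a\<^sup>2 + r\<^sup>2)"
    by (intro tendsto_intros) auto
  then show ?thesis by (simp add: mu_def mu_inf_def real)
next
  case PInf
  have "filterlim c at_top sequentially"
    using lim PInf by (simp add: tendsto_PInfty_eq_at_top)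
  then have "(\<lambda>k. a / c k) \<longlonglongrightarrow> 0"
    by (intro real_tendsto_divide_at_top[OF tendsto_const])
  moreover have "mu a (c k) \<le> a / c k" for k
  proof -
    have "c k \<le> sqrt (a\<^sup>2 + (c k)\<^sup>2)" by (rule real_le_rsqrt) simp
    then show ?thesis
      unfolding mu_def using pos \<open>a \<ge> 0\<close> less_le_trans[of 0 "c k"]
      by (intro divide_left_mono mult_pos_pos) blast+
  qed
  ultimately have "(\<lambda>k. mu a (c k)) \<longlonglongrightarrow> 0"
    using tendsto_sandwich[OF always_eventually always_eventually tendsto_const]
      mu_nonneg[OF \<open>a \<ge> 0\<close>] by metis
  then show ?thesis by (simp add: mu_inf_def PInf)
next
  case MInf
  have "\<forall>k. 0 \<le> ereal (c k)" using pos by (simp add: less_imp_le)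
  then have "0 \<le> c_inf" using LIMSEQ_le_const[OF lim] by blast
  with MInf show ?thesis by simp
qed

section \<open>Strong convergence and the linear rate\<close>

theorem theorem3p2:
  fixes T :: "'a::{real_inner, complete_space} \<Rightarrow> 'a set"
    and z zbar :: "nat \<Rightarrow> 'a"
    and c \<delta> :: "nat \<Rightarrow> real"
    and c_inf :: ereal
    and a :: real
  assumes "maximal_monotone T"
    and "inverse_operator T 0 \<noteq> {}"
    and "\<forall>k. 0 < c k"
    and "incseq c"
    and "(\<lambda>k. ereal (c k)) \<longlonglongrightarrow> c_inf"
    and "halpern_iteration z zbar"
    and "criterion_B T c \<delta> z zbar"
    and "bounded (range z)"
    and "inverse_lipschitz_at_0 T a"
  shows "(\<forall>k. mu a (c k) < 1) \<and>
    (\<exists>zs. inverse_operator T 0 = {zs} \<and>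
      z \<longlonglongrightarrow> zs \<and>
      (\<exists>kbar. \<forall>k\<ge>kbar.
          norm (zbar k - zs) \<le> vartheta a c \<delta> k * norm (z k - zs) \<and>
          0 \<le> vartheta a c \<delta> k \<and> vartheta a c \<delta> k < 1) \<and>
      vartheta a c \<delta> \<longlonglongrightarrow> mu_inf a c_inf)"
proof -
  note T = assms(1)
  have c: "0 < c k" for k using assms(3) by simp
  have c0: "c 0 \<le> c k" for k using \<open>incseq c\<close> by (simp add: incseq_def)
  from assms(9) obtain zs \<epsilon> where a: "a \<ge> 0" and inv: "inverse_operator T 0 = {zs}" and \<epsilon>: "\<epsilon> > 0"
    and lip': "\<forall>w x. x \<in> inverse_operator T w \<longrightarrow> norm w \<le> \<epsilon> \<longrightarrow> norm (x - zs) \<le> a * norm w"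
    unfolding inverse_lipschitz_at_0_def by blast
  have lip: "norm (x - zs) \<le> a * norm w" if "w \<in> T x" "norm w \<le> \<epsilon>" for w x
    using lip' that by (simp add: inverse_operator_def)
  have zs: "0 \<in> T zs" using inv by (auto simp: inverse_operator_def)
  have \<delta>0: "0 \<le> \<delta> k" and crit: "norm (zbar k - prox_map T (c k) (z k)) \<le> \<delta> k * norm (zbar k - z k)" for k
    using assms(7) by (auto simp: criterion_B_def)
  have \<delta>: "\<delta> \<longlonglongrightarrow> 0"
    using assms(7) by (auto simp: criterion_B_def summable_LIMSEQ_zero)
  define v where "v k = norm (z k - zs)" for k
  \<comment> \<open>The error in criterion (B) involves \<open>zbar k\<close> itself; its share
    \<open>\<delta> k * norm (zbar k - zs)\<close> is absorbed on the left. Used with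
    \<open>r = \<rho>\<close> for convergence and with \<open>r = mu a (c k)\<close> for the
    rate.\<close>
  have transfer: "(1 - \<delta> k) * norm (zbar k - zs) \<le> (r + \<delta> k) * v k"
    if "norm (prox_map T (c k) (z k) - zs) \<le> r * v k" for k r
  proof -
    have "norm (zbar k - zs) \<le>
        norm (zbar k - prox_map T (c k) (z k)) + norm (prox_map T (c k) (z k) - zs)"
      using norm_triangle_ineq[of "zbar k - prox_map T (c k) (z k)" "prox_map T (c k) (z k) - zs"]
      by simp
    moreover have "norm (zbar k - z k) \<le> norm (zbar k - zs) + v k"
      using norm_triangle_ineq4[of "zbar k - zs" "z k - zs"] by (simp add: v_def)
    then have "\<delta> k * norm (zbar k - z k) \<le> \<delta> k * (norm (zbar k - zs) + v k)"
      using \<delta>0 by (rule mult_left_mono)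
    ultimately show ?thesis using that crit[of k] by (simp add: algebra_simps)
  qed
  from \<open>bounded (range z)\<close> obtain B where B: "\<And>k. norm (z k) \<le> B"
    by (auto simp: bounded_iff)
  define M where "M = B + norm zs"
  have M: "v k \<le> M" for k
    using norm_triangle_ineq4[of "z k" zs] B[of k] by (simp add: v_def M_def)
  obtain \<rho> where \<rho>: "0 \<le> \<rho>" "\<rho> < 1"
    and "\<And>c' y. c 0 \<le> c' \<Longrightarrow> norm (y - zs) \<le> M \<Longrightarrow> norm (prox_map T c' y - zs) \<le> \<rho> * norm (y - zs)"
    using prox_map_uniform_contraction[OF T zs a \<epsilon> c[of 0] lip] by metis
  then have contr: "norm (prox_map T (c k) (z k) - zs) \<le> \<rho> * v k" for k
    using c0 M by (simp add: v_def)
  have "v \<longlonglongrightarrow> 0"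
  proof (rule perturbed_contraction_tendsto_0)
    show "0 \<le> v k" for k by (simp add: v_def)
    \<comment> \<open>A factor strictly between \<open>1\<close> and \<open>\<rho>\<close>, the
      limit of \<open>(\<rho> + \<delta> k) / (1 - \<delta> k)\<close>; the perturbation is the
      share \<open>1 / (k + 2)\<close> of the anchor \<open>z 0\<close>.\<close>
    show "0 \<le> (1 + \<rho>) / 2" "(1 + \<rho>) / 2 < 1" using \<rho> by auto
    show "(\<lambda>k. v 0 / real (Suc (Suc k))) \<longlonglongrightarrow> 0"
      by (intro LIMSEQ_Suc lim_const_over_n)
    have "(\<lambda>k. (\<rho> + \<delta> k) / (1 - \<delta> k)) \<longlonglongrightarrow> (\<rho> + 0) / (1 - 0)"
      by (intro tendsto_intros \<delta>) auto
    then have "\<forall>\<^sub>F k in sequentially. (\<rho> + \<delta> k) / (1 - \<delta> k) < (1 + \<rho>) / 2"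
      using \<rho> by (intro order_tendstoD) auto
    moreover have "\<forall>\<^sub>F k in sequentially. \<delta> k < 1"
      using \<delta> by (intro order_tendstoD) auto
    ultimately show "\<forall>\<^sub>F k in sequentially.
        v (Suc k) \<le> (1 + \<rho>) / 2 * v k + v 0 / real (Suc (Suc k))"
    proof eventually_elim
      case (elim k)
      define s where "s = 1 / (real k + 2)"
      have s: "0 \<le> s" "s \<le> 1" "(real k + 1) / (real k + 2) = 1 - s"
        by (auto simp: s_def field_simps)
      have "z (Suc k) = s *\<^sub>R z 0 + (1 - s) *\<^sub>R zbar k"
        using assms(6) s(3) by (simp add: halpern_iteration_def s_def)
      then have "z (Suc k) - zs = s *\<^sub>R (z 0 - zs) + (1 - s) *\<^sub>R (zbar k - zs)"
        by (simp add: algebra_simps)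
      then have "v (Suc k) \<le> s * v 0 + (1 - s) * norm (zbar k - zs)"
        using norm_triangle_ineq[of "s *\<^sub>R (z 0 - zs)" "(1 - s) *\<^sub>R (zbar k - zs)"] s
        by (simp add: v_def)
      also have "\<dots> \<le> s * v 0 + 1 * norm (zbar k - zs)"
        using s by (intro add_left_mono mult_right_mono) auto
      also have "norm (zbar k - zs) \<le> (\<rho> + \<delta> k) / (1 - \<delta> k) * v k"
        using transfer[OF contr, of k] elim by (simp add: field_simps)
      also have "\<dots> \<le> (1 + \<rho>) / 2 * v k"
        using elim by (intro mult_right_mono) (auto simp: v_def)
      finally show ?case by (simp add: s_def algebra_simps)
    qed
  qed
  then have z_lim: "z \<longlonglongrightarrow> zs"
    by (simp add: v_def[abs_def] tendsto_norm_zero_iff LIM_zero_iff)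
  have \<mu>: "0 \<le> mu a (c k)" "mu a (c k) < 1" "mu a (c k) \<le> mu a (c 0)" for k
    by (rule mu_nonneg[OF a] mu_less_1[OF a c] mu_antimono[OF a c c0])+
  have "\<forall>\<^sub>F k in sequentially. v k < c 0 * \<epsilon>"
    using \<open>v \<longlonglongrightarrow> 0\<close> c \<epsilon> by (intro order_tendstoD) auto
  \<comment> \<open>This threshold is \<open>mu + \<delta> k < 1 - \<delta> k\<close> solved for
    \<open>\<delta> k\<close>, with \<open>mu\<close> at its largest value
    \<open>mu a (c 0)\<close>; it forces \<open>vartheta\<close> below \<open>1\<close>.\<close>
  moreover have "\<forall>\<^sub>F k in sequentially. \<delta> k < (1 - mu a (c 0)) / 2"
    using \<delta> \<mu>(2)[of 0] by (intro order_tendstoD) auto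
  ultimately have "\<forall>\<^sub>F k in sequentially.
      norm (zbar k - zs) \<le> vartheta a c \<delta> k * norm (z k - zs) \<and>
      0 \<le> vartheta a c \<delta> k \<and> vartheta a c \<delta> k < 1"
  proof eventually_elim
    case (elim k)
    have "2 * \<delta> k < 1 - mu a (c 0)" using elim by simp
    then have \<delta>1: "\<delta> k < 1" "mu a (c k) + \<delta> k < 1 - \<delta> k"
      using \<mu>(1)[of 0] \<mu>(3)[of k] \<delta>0[of k] by simp_all
    \<comment> \<open>Monotonicity of \<open>c\<close> lets one threshold on \<open>v k\<close> meet
      the smallness condition for every later parameter.\<close>
    have "c 0 * \<epsilon> \<le> c k * \<epsilon>" using c0 \<epsilon> by (intro mult_right_mono) auto
    with elim have "norm (z k - zs) \<le> c k * \<epsilon>" by (simp add: v_def)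
    then have "norm (prox_map T (c k) (z k) - zs) \<le> mu a (c k) * v k"
      unfolding v_def by (intro prox_map_mu_contraction[OF T zs a c lip])
    from transfer[OF this] have "norm (zbar k - zs) \<le> vartheta a c \<delta> k * norm (z k - zs)"
      using \<delta>1 by (simp add: vartheta_def v_def field_simps)
    moreover have "0 \<le> vartheta a c \<delta> k" "vartheta a c \<delta> k < 1"
      using \<delta>1 \<mu>(1)[of k] \<delta>0[of k] by (auto simp: vartheta_def)
    ultimately show ?case by blast
  qed
  moreover have "vartheta a c \<delta> \<longlonglongrightarrow> mu_inf a c_inf"
  proof -
    have "(\<lambda>k. (mu a (c k) + \<delta> k) / (1 - \<delta> k)) \<longlonglongrightarrow> (mu_inf a c_inf + 0) / (1 - 0)"
      by (intro tendsto_intros mu_tendsto_mu_inf[OF a assms(3-5)] \<delta>) auto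
    then show ?thesis by (simp add: vartheta_def[abs_def])
  qed
  ultimately show ?thesis
    using \<mu>(2) inv z_lim unfolding eventually_sequentially by blast
qed

end
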